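(* Let $X$ be an infinite uniform Hausdorff space whose uniformity is given by a uniform neighborhood system $(V,\succcurlyeq)$ with index set $\Lambda$, and let $f : X \to X$ be a continuous mapping. If $f$ is chaotic on $X$, then $f$ has sensitive dependence on initial conditions; that is, there exists $\alpha\in\Lambda$ such that for every $x\in X$ and every neighborhood $N(x)$ of $x$ there exist $y\in N(x)$ with $y\neq x$ and $n\in\mathbb{N}$ such that $f^n(x)\notin V_\alpha(f^n(y))$.
   Context: Uniform neighborhood system: a nonvoid set $X$, an index set $\Lambda$, an ordering $\succcurlyeq$ on $\Lambda$, and a function $V:\Lambda\times X\to\mathcal{P}(X)$, written $(\alpha,x)\mapsto V_\alpha(x)$, such that: (1) $x\in V_\alpha(x)$ for all $\alpha\in\Lambda$, $x\in X$; (2) $\succcurlyeq$ directs $\Lambda$ (so $\Lambda$ is nonempty and for all $\alpha,\beta\in\Lambda$ there is $\gamma\in\Lambda$ with $\gamma\succcurlyeq\alpha$ and $\gamma\succcurlyeq\beta$); (3) if $\alpha\succcurlyeq\beta$, then $V_\alpha(x)\subset V_\beta(x)$ for all $x$; (4) for every $\alpha\in\Lambda$ there is $\beta\in\Lambda$ such that $y\in V_\alpha(x)$ whenever $x\in V_\beta(y)$; (5) for every $\alpha\in\Lambda$ there is $\beta\in\Lambda$ such that $z\in V_\alpha(x)$ whenever $y\in V_\beta(x)$ and $z\in V_\beta(y)$. The sets $\{(x,y): y\in V_\alpha(x)\}$, $\alpha\in\Lambda$, form a base for a uniformity on $X$ (the uniformity of the system), and $X$ carries the corresponding uniform topology, for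 which $\{V_\alpha(x):\alpha\in\Lambda\}$ is a neighborhood base at each $x\in X$. Here $f^n$ denotes the $n$-th iterate of $f$, and $\mathbb{N}$ is the set of positive integers. The forward orbit of $x$ is $O(x)=\{x,f(x),f^2(x),\dots\}$. A point $p$ is periodic if $f^n(p)=p$ for some positive integer $n$. Chaotic: a continuous map $f:X\to X$ of a topological space is chaotic on $X$ if for any two nonvoid open subsets $U,V$ of $X$ there is a periodic point $p\in X$ of $f$ such that $U\cap O(p)\neq\emptyset$ and $V\cap O(p)\neq\emptyset$. *)

theory Defs
  imports "HOL-Analysis.Analysis"
begin

text \<open>
  The relation is only required to be a preorder on the index set, as usual for a relation that
  directs a set; antisymmetry is not assumed.
\<close>

locale uniform_neighborhood_system =
  fixes X :: "'a set"
    and \<Lambda> :: "'i set"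
    and geq :: "'i \<Rightarrow> 'i \<Rightarrow> bool" (infix "\<succcurlyeq>" 50)
    and V :: "'i \<Rightarrow> 'a \<Rightarrow> 'a set"
  assumes carrier_nonempty: "X \<noteq> {}"
    and range_V: "\<lbrakk>\<alpha> \<in> \<Lambda>; x \<in> X\<rbrakk> \<Longrightarrow> V \<alpha> x \<subseteq> X"
    and center: "\<lbrakk>\<alpha> \<in> \<Lambda>; x \<in> X\<rbrakk> \<Longrightarrow> x \<in> V \<alpha> x"
    and index_nonempty: "\<Lambda> \<noteq> {}"
    and geq_refl: "reflp_on \<Lambda> (\<succcurlyeq>)"
    and geq_trans: "transp_on \<Lambda> (\<succcurlyeq>)"
    and directed: "\<lbrakk>\<alpha> \<in> \<Lambda>; \<beta> \<in> \<Lambda>\<rbrakk> \<Longrightarrow> \<exists>\<gamma>\<in>\<Lambda>. \<gamma> \<succcurlyeq> \<alpha> \<and> \<gamma> \<succcurlyeq> \<beta>"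
    and antimono_V: "\<lbrakk>\<alpha> \<in> \<Lambda>; \<beta> \<in> \<Lambda>; \<alpha> \<succcurlyeq> \<beta>; x \<in> X\<rbrakk> \<Longrightarrow> V \<alpha> x \<subseteq> V \<beta> x"
    and symmetric_V: "\<alpha> \<in> \<Lambda> \<Longrightarrow> \<exists>\<beta>\<in>\<Lambda>. \<forall>x\<in>X. \<forall>y\<in>X. x \<in> V \<beta> y \<longrightarrow> y \<in> V \<alpha> x"
    and triangle_V: "\<alpha> \<in> \<Lambda> \<Longrightarrow>
      \<exists>\<beta>\<in>\<Lambda>. \<forall>x\<in>X. \<forall>y\<in>X. \<forall>z\<in>X. y \<in> V \<beta> x \<and> z \<in> V \<beta> y \<longrightarrow> z \<in> V \<alpha> x"

definition entourages :: "'a set \<Rightarrow> 'i set \<Rightarrow> ('i \<Rightarrow> 'a \<Rightarrow> 'a set) \<Rightarrow> ('a \<times> 'a) set set" where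
  "entourages X \<Lambda> V =
    {E. E \<subseteq> X \<times> X \<and> (\<exists>\<alpha>\<in>\<Lambda>. {(x, y). x \<in> X \<and> y \<in> V \<alpha> x} \<subseteq> E)}"

definition unif_topology :: "'a set \<Rightarrow> 'i set \<Rightarrow> ('i \<Rightarrow> 'a \<Rightarrow> 'a set) \<Rightarrow> 'a topology" where
  "unif_topology X \<Lambda> V =
    topology (\<lambda>U. U \<subseteq> X \<and> (\<forall>x\<in>U. \<exists>E\<in>entourages X \<Lambda> V. E `` {x} \<subseteq> U))"

definition neighborhood_of :: "'a topology \<Rightarrow> 'a \<Rightarrow> 'a set \<Rightarrow> bool" where
  "neighborhood_of T x N \<longleftrightarrow> N \<subseteq> topspace T \<and> (\<exists>U. openin T U \<and> x \<in> U \<and> U \<subseteq> N)"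

definition forward_orbit :: "('a \<Rightarrow> 'a) \<Rightarrow> 'a \<Rightarrow> 'a set" where
  "forward_orbit f x = {(f ^^ n) x | n. True}"

definition periodic_point :: "('a \<Rightarrow> 'a) \<Rightarrow> 'a \<Rightarrow> bool" where
  "periodic_point f p \<longleftrightarrow> (\<exists>n>0. (f ^^ n) p = p)"

definition chaotic_on :: "'a topology \<Rightarrow> ('a \<Rightarrow> 'a) \<Rightarrow> bool" where
  "chaotic_on T f \<longleftrightarrow> continuous_map T T f \<and>
    (\<forall>U W. openin T U \<and> U \<noteq> {} \<and> openin T W \<and> W \<noteq> {} \<longrightarrow>
      (\<exists>p\<in>topspace T. periodic_point f p \<and>
        U \<inter> forward_orbit f p \<noteq> {} \<and> W \<inter> forward_orbit f p \<noteq> {}))"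

definition sensitive_dependence ::
  "'a set \<Rightarrow> 'i set \<Rightarrow> ('i \<Rightarrow> 'a \<Rightarrow> 'a set) \<Rightarrow> ('a \<Rightarrow> 'a) \<Rightarrow> bool" where
  "sensitive_dependence X \<Lambda> V f \<longleftrightarrow>
    (\<exists>\<alpha>\<in>\<Lambda>. \<forall>x\<in>X. \<forall>N. neighborhood_of (unif_topology X \<Lambda> V) x N \<longrightarrow>
      (\<exists>y\<in>N. y \<noteq> x \<and> (\<exists>n>0. (f ^^ n) x \<notin> V \<alpha> ((f ^^ n) y))))"

context uniform_neighborhood_system
begin

lemma basic_entourage:
  assumes "\<alpha> \<in> \<Lambda>"
  shows "{(x, y). x \<in> X \<and> y \<in> V \<alpha> x} \<in> entourages X \<Lambda> V"
  using assms range_V by (fastforce simp: entourages_def)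

lemma entourage_section_iff:
  assumes "x \<in> X"
  shows "(\<exists>E\<in>entourages X \<Lambda> V. E `` {x} \<subseteq> U) \<longleftrightarrow> (\<exists>\<alpha>\<in>\<Lambda>. V \<alpha> x \<subseteq> U)"
proof
  assume "\<exists>E\<in>entourages X \<Lambda> V. E `` {x} \<subseteq> U"
  then obtain E \<alpha> where "E `` {x} \<subseteq> U" "\<alpha> \<in> \<Lambda>" "{(x, y). x \<in> X \<and> y \<in> V \<alpha> x} \<subseteq> E"
    by (auto simp: entourages_def)
  with assms show "\<exists>\<alpha>\<in>\<Lambda>. V \<alpha> x \<subseteq> U" by blast
next
  assume "\<exists>\<alpha>\<in>\<Lambda>. V \<alpha> x \<subseteq> U"
  then obtain \<alpha> where "\<alpha> \<in> \<Lambda>" "V \<alpha> x \<subseteq> U" by blast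
  then show "\<exists>E\<in>entourages X \<Lambda> V. E `` {x} \<subseteq> U"
    by (intro bexI[OF _ basic_entourage]) auto
qed

lemma istopology_unif:
  "istopology (\<lambda>U. U \<subseteq> X \<and> (\<forall>x\<in>U. \<exists>E\<in>entourages X \<Lambda> V. E `` {x} \<subseteq> U))"
  unfolding istopology_def
proof (intro conjI allI impI)
  fix S T
  assume S: "S \<subseteq> X \<and> (\<forall>x\<in>S. \<exists>E\<in>entourages X \<Lambda> V. E `` {x} \<subseteq> S)"
    and T: "T \<subseteq> X \<and> (\<forall>x\<in>T. \<exists>E\<in>entourages X \<Lambda> V. E `` {x} \<subseteq> T)"
  show "S \<inter> T \<subseteq> X" using S by blast
  show "\<forall>x\<in>S \<inter> T. \<exists>E\<in>entourages X \<Lambda> V. E `` {x} \<subseteq> S \<inter> T"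
  proof
    fix x assume x: "x \<in> S \<inter> T"
    then have xX: "x \<in> X" using S by blast
    obtain \<alpha> where \<alpha>: "\<alpha> \<in> \<Lambda>" "V \<alpha> x \<subseteq> S" using S x entourage_section_iff[OF xX, of S] by auto
    obtain \<beta> where \<beta>: "\<beta> \<in> \<Lambda>" "V \<beta> x \<subseteq> T" using T x entourage_section_iff[OF xX, of T] by auto
    obtain \<gamma> where \<gamma>: "\<gamma> \<in> \<Lambda>" "\<gamma> \<succcurlyeq> \<alpha>" "\<gamma> \<succcurlyeq> \<beta>" using directed \<alpha>(1) \<beta>(1) by blast
    have "V \<gamma> x \<subseteq> S \<inter> T"
      using antimono_V[OF \<gamma>(1) \<alpha>(1) \<gamma>(2) xX] antimono_V[OF \<gamma>(1) \<beta>(1) \<gamma>(3) xX] \<alpha>(2) \<beta>(2) by blast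
    with \<gamma>(1) show "\<exists>E\<in>entourages X \<Lambda> V. E `` {x} \<subseteq> S \<inter> T"
      unfolding entourage_section_iff[OF xX] by (rule rev_bexI)
  qed
next
  fix \<K>
  assume K: "\<forall>K\<in>\<K>. K \<subseteq> X \<and> (\<forall>x\<in>K. \<exists>E\<in>entourages X \<Lambda> V. E `` {x} \<subseteq> K)"
  show "\<Union>\<K> \<subseteq> X" using K by blast
  show "\<forall>x\<in>\<Union>\<K>. \<exists>E\<in>entourages X \<Lambda> V. E `` {x} \<subseteq> \<Union>\<K>"
  proof
    fix x assume "x \<in> \<Union>\<K>"
    then obtain K where "K \<in> \<K>" "x \<in> K" by blast
    moreover from this K obtain E where "E \<in> entourages X \<Lambda> V" "E `` {x} \<subseteq> K" by meson
    ultimately show "\<exists>E\<in>entourages X \<Lambda> V. E `` {x} \<subseteq> \<Union>\<K>" by (meson Union_upper subset_trans)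
  qed
qed

lemma openin_unif_topology:
  "openin (unif_topology X \<Lambda> V) U \<longleftrightarrow> U \<subseteq> X \<and> (\<forall>x\<in>U. \<exists>\<alpha>\<in>\<Lambda>. V \<alpha> x \<subseteq> U)"
proof -
  have "openin (unif_topology X \<Lambda> V) U \<longleftrightarrow>
      U \<subseteq> X \<and> (\<forall>x\<in>U. \<exists>E\<in>entourages X \<Lambda> V. E `` {x} \<subseteq> U)"
    unfolding unif_topology_def by (simp add: topology_inverse'[OF istopology_unif])
  also have "\<dots> \<longleftrightarrow> U \<subseteq> X \<and> (\<forall>x\<in>U. \<exists>\<alpha>\<in>\<Lambda>. V \<alpha> x \<subseteq> U)"
    by (intro conj_cong refl ball_cong entourage_section_iff) (erule (1) subsetD)
  finally show ?thesis .
qed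

lemma topspace_unif_topology: "topspace (unif_topology X \<Lambda> V) = X"
proof -
  have "openin (unif_topology X \<Lambda> V) X"
    unfolding openin_unif_topology using range_V index_nonempty by blast
  moreover have "topspace (unif_topology X \<Lambda> V) \<subseteq> X"
    using openin_topspace[of "unif_topology X \<Lambda> V"] unfolding openin_unif_topology by blast
  ultimately show ?thesis by (meson openin_subset subset_antisym)
qed

lemma neighborhood_of_unif_topology:
  assumes x: "x \<in> X"
  shows "neighborhood_of (unif_topology X \<Lambda> V) x N \<longleftrightarrow> N \<subseteq> X \<and> (\<exists>\<alpha>\<in>\<Lambda>. V \<alpha> x \<subseteq> N)"
proof
  assume "neighborhood_of (unif_topology X \<Lambda> V) x N"
  then show "N \<subseteq> X \<and> (\<exists>\<alpha>\<in>\<Lambda>. V \<alpha> x \<subseteq> N)"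
    unfolding neighborhood_of_def topspace_unif_topology openin_unif_topology by blast
next
  assume N: "N \<subseteq> X \<and> (\<exists>\<alpha>\<in>\<Lambda>. V \<alpha> x \<subseteq> N)"
  define U where "U = {y \<in> X. \<exists>\<alpha>\<in>\<Lambda>. V \<alpha> y \<subseteq> N}"
  have "\<exists>\<beta>\<in>\<Lambda>. V \<beta> y \<subseteq> U" if "y \<in> U" for y
  proof -
    from that obtain \<alpha> where \<alpha>: "y \<in> X" "\<alpha> \<in> \<Lambda>" "V \<alpha> y \<subseteq> N" by (auto simp: U_def)
    from triangle_V[OF \<alpha>(2)] obtain \<beta> where \<beta>: "\<beta> \<in> \<Lambda>"
      "\<forall>x\<in>X. \<forall>y\<in>X. \<forall>z\<in>X. y \<in> V \<beta> x \<and> z \<in> V \<beta> y \<longrightarrow> z \<in> V \<alpha> x" by blast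
    have "V \<beta> y \<subseteq> U"
    proof
      fix z assume z: "z \<in> V \<beta> y"
      then have zX: "z \<in> X" using range_V \<alpha>(1) \<beta>(1) by blast
      have "V \<beta> z \<subseteq> V \<alpha> y" using \<beta>(2) z zX \<alpha>(1) range_V[OF \<beta>(1) zX] by (meson subset_iff)
      then show "z \<in> U" using \<alpha>(3) \<beta>(1) zX by (auto simp: U_def)
    qed
    with \<beta>(1) show ?thesis by blast
  qed
  then have "openin (unif_topology X \<Lambda> V) U" by (auto simp: openin_unif_topology U_def)
  moreover have "x \<in> U" using x N by (simp add: U_def)
  moreover have "U \<subseteq> N" using center by (auto simp: U_def)
  ultimately show "neighborhood_of (unif_topology X \<Lambda> V) x N"
    using N by (auto simp: neighborhood_of_def topspace_unif_topology)
qed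

end

end

(*
  A chaotic map on an infinite Hausdorff space has two disjoint periodic orbits, and since these are
  finite there is an index \<delta> such that no x is \<delta>-close to both.  Given x, let q lie on the orbit
  far from x and let p be a periodic point near x, of period n.  By chaos there is a point y near x
  whose orbit enters a set that shadows q for n steps, so for some j the point f^(n j) y is close to
  the orbit of q whereas f^(n j) p = p is close to x.  Hence f^(n j) x cannot be close to both.
*)
theory Submission
  imports Defs
begin

section \<open>Periodic points and their orbits under iteration\<close>

lemma periodic_orbit_finite:
  assumes "periodic_point f p"
  shows "finite (forward_orbit f p)"
proof -
  obtain n where n: "n > 0" "(f ^^ n) p = p" using assms by (auto simp: periodic_point_def)
  have "(f ^^ k) p \<in> (\<lambda>i. (f ^^ i) p) ` {..<n}" for k
    using n by (intro image_eqI[where x = "k mod n"]) (simp_all add: funpow_mod_eq)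
  then have "forward_orbit f p \<subseteq> (\<lambda>i. (f ^^ i) p) ` {..<n}"
    by (auto simp: forward_orbit_def)
  then show ?thesis by (rule finite_subset) simp
qed

lemma funpow_mult_period:
  assumes "(f ^^ n) p = p"
  shows "(f ^^ (n * j)) p = p"
  using assms by (induction j) (simp_all add: funpow_add)

text \<open>Steps backwards along a cycle can be replaced by steps forwards, so the order in which
  the orbit of \<open>p\<close> visits two points does not matter.\<close>

lemma periodic_orbit_return:
  assumes "periodic_point f p" "u \<in> forward_orbit f p" "w \<in> forward_orbit f p"
  shows "\<exists>k. w = (f ^^ k) u"
proof -
  obtain n where n: "n > 0" "(f ^^ n) p = p" using assms(1) by (auto simp: periodic_point_def)
  obtain i k where ik: "u = (f ^^ i) p" "w = (f ^^ k) p"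
    using assms(2,3) by (auto simp: forward_orbit_def)
  \<comment> \<open>The \<open>n * i - i\<close> steps complete the \<open>i\<close> steps from
    \<open>p\<close> to \<open>u\<close> to \<open>i\<close> full periods, leading back to
    \<open>p\<close>; \<open>n > 0\<close> ensures that the subtraction is not truncated.\<close>
  have "(f ^^ (k + (n * i - i))) u = (f ^^ (k + (n * i - i) + i)) p"
    by (simp only: ik funpow_add o_apply)
  also have "k + (n * i - i) + i = k + n * i" using n(1) by (cases n) simp_all
  also have "(f ^^ (k + n * i)) p = w"
    by (simp add: funpow_add funpow_mult_period[OF n(2)] ik)
  finally show ?thesis by metis
qed

lemma periodic_point_orbit:
  assumes "periodic_point f p" "u \<in> forward_orbit f p"
  shows "periodic_point f u"
proof -
  obtain n i where n: "n > 0" "(f ^^ n) p = p" and u: "u = (f ^^ i) p"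
    using assms by (auto simp: periodic_point_def forward_orbit_def)
  have "(f ^^ n) u = (f ^^ (n + i)) p" by (simp add: u funpow_add)
  also have "\<dots> = (f ^^ (i + n)) p" by (simp only: add.commute)
  also have "\<dots> = u" by (simp add: u funpow_add n)
  finally show ?thesis using n(1) by (auto simp: periodic_point_def)
qed

text \<open>From a common point one could go on along the cycle of \<open>q\<close> to
  \<open>w\<close>, and so reach \<open>w\<close> from \<open>p\<close>.\<close>

lemma periodic_orbits_disjoint:
  assumes "periodic_point f q" "w \<in> forward_orbit f q" "w \<notin> forward_orbit f p"
  shows "forward_orbit f p \<inter> forward_orbit f q = {}"
proof (rule ccontr)
  assume "forward_orbit f p \<inter> forward_orbit f q \<noteq> {}"
  then obtain u i where u: "u = (f ^^ i) p" "u \<in> forward_orbit f q"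
    by (auto simp: forward_orbit_def)
  obtain k where "w = (f ^^ k) u" using periodic_orbit_return[OF assms(1) u(2) assms(2)] by blast
  then have "w = (f ^^ (k + i)) p" by (simp add: u funpow_add)
  then show False using assms(3) by (auto simp: forward_orbit_def)
qed

section \<open>Continuous and chaotic maps on a topological space\<close>

lemma continuous_map_funpow:
  assumes "continuous_map T T f"
  shows "continuous_map T T (f ^^ n)"
proof (induction n)
  case (Suc n)
  show ?case unfolding funpow.simps by (rule continuous_map_compose[OF Suc assms])
qed simp

lemma forward_orbit_subset_topspace:
  assumes "continuous_map T T f" "p \<in> topspace T"
  shows "forward_orbit f p \<subseteq> topspace T"
  using continuous_map_image_subset_topspace[OF continuous_map_funpow[OF assms(1)]] assms(2)
  by (auto simp: forward_orbit_def)

text \<open>Chaos on the whole space yields \<open>p\<close>. Its orbit is finite, hence closed, so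
  the complement is open, and nonempty as the space is infinite; chaos there yields
  \<open>q\<close>.\<close>

lemma chaotic_disjoint_orbits:
  assumes "chaotic_on T f" "Hausdorff_space T" "infinite (topspace T)"
  obtains p q where "p \<in> topspace T" "q \<in> topspace T" "periodic_point f p" "periodic_point f q"
    "forward_orbit f p \<inter> forward_orbit f q = {}"
proof -
  have cont: "continuous_map T T f" using assms(1) by (simp add: chaotic_on_def)
  have per: "\<exists>p\<in>topspace T. periodic_point f p \<and> U \<inter> forward_orbit f p \<noteq> {}"
    if "openin T U" "U \<noteq> {}" for U
    using assms(1) that unfolding chaotic_on_def by blast
  have "topspace T \<noteq> {}" using assms(3) by auto
  with per[OF openin_topspace] obtain p where p: "p \<in> topspace T" "periodic_point f p" by blast
  let ?W = "topspace T - forward_orbit f p"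
  have fin: "finite (forward_orbit f p)" by (rule periodic_orbit_finite[OF p(2)])
  have "closedin T (forward_orbit f p)"
    using fin forward_orbit_subset_topspace[OF cont p(1)] assms(2)
    by (intro closedin_Hausdorff_finite)
  then have "openin T ?W" by (simp add: openin_diff)
  moreover have "?W \<noteq> {}" using Diff_infinite_finite[OF fin assms(3)] by (rule infinite_imp_nonempty)
  ultimately obtain q w where q: "q \<in> topspace T" "periodic_point f q"
    and "w \<in> ?W" "w \<in> forward_orbit f q" using per by blast
  then have "forward_orbit f p \<inter> forward_orbit f q = {}"
    by (intro periodic_orbits_disjoint[where w = w]) auto
  with p q show ?thesis by (intro that)
qed

section \<open>Closeness and separation in a uniform neighborhood system\<close>

context uniform_neighborhood_system
begin

text \<open>Membership in \<open>V\<close> need not be symmetric; the symmetrized relation lets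
  chains of close points be read in either direction.\<close>

definition near :: "'i \<Rightarrow> 'a \<Rightarrow> 'a \<Rightarrow> bool" where
  "near \<alpha> x y \<longleftrightarrow> y \<in> V \<alpha> x \<or> x \<in> V \<alpha> y"

lemma finite_common_refinement:
  assumes "finite A" "A \<subseteq> \<Lambda>"
  shows "\<exists>\<gamma>\<in>\<Lambda>. \<forall>\<alpha>\<in>A. \<forall>x\<in>X. V \<gamma> x \<subseteq> V \<alpha> x"
  using assms
proof (induction rule: finite_induct)
  case empty
  then show ?case using index_nonempty by blast
next
  case (insert \<alpha> A)
  then obtain \<beta> where \<beta>: "\<beta> \<in> \<Lambda>" "\<forall>\<alpha>\<in>A. \<forall>x\<in>X. V \<beta> x \<subseteq> V \<alpha> x" by auto
  have \<alpha>: "\<alpha> \<in> \<Lambda>" using insert.prems by simp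
  obtain \<gamma> where \<gamma>: "\<gamma> \<in> \<Lambda>" "\<gamma> \<succcurlyeq> \<alpha>" "\<gamma> \<succcurlyeq> \<beta>" using directed[OF \<alpha> \<beta>(1)] by blast
  have "V \<gamma> x \<subseteq> V \<alpha> x" "V \<gamma> x \<subseteq> V \<beta> x" if "x \<in> X" for x
    using antimono_V \<alpha> \<beta>(1) \<gamma> that by blast+
  with \<gamma>(1) \<beta>(2) show ?case by (intro bexI[of _ \<gamma>]) blast+
qed

lemma near_compose:
  assumes "\<alpha> \<in> \<Lambda>"
  shows "\<exists>\<beta>\<in>\<Lambda>. \<forall>x\<in>X. \<forall>y\<in>X. \<forall>z\<in>X. near \<beta> x y \<and> near \<beta> y z \<longrightarrow> z \<in> V \<alpha> x"
proof -
  obtain \<beta> where \<beta>: "\<beta> \<in> \<Lambda>"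
    "\<And>x y z. \<lbrakk>x \<in> X; y \<in> X; z \<in> X; y \<in> V \<beta> x; z \<in> V \<beta> y\<rbrakk> \<Longrightarrow> z \<in> V \<alpha> x"
    using triangle_V[OF assms] by meson
  obtain \<gamma> where \<gamma>: "\<gamma> \<in> \<Lambda>" "\<And>x y. \<lbrakk>x \<in> X; y \<in> X; x \<in> V \<gamma> y\<rbrakk> \<Longrightarrow> y \<in> V \<beta> x"
    using symmetric_V[OF \<beta>(1)] by meson
  \<comment> \<open>Below \<open>\<beta>\<close> a link in the right direction is usable as it is;
    below \<open>\<gamma>\<close> a reversed link can be turned around.\<close>
  obtain \<delta> where \<delta>: "\<delta> \<in> \<Lambda>" "\<forall>\<alpha>\<in>{\<beta>, \<gamma>}. \<forall>x\<in>X. V \<delta> x \<subseteq> V \<alpha> x"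
    using finite_common_refinement[of "{\<beta>, \<gamma>}"] \<beta>(1) \<gamma>(1) by auto
  have "y \<in> V \<beta> x" if "x \<in> X" "y \<in> X" "near \<delta> x y" for x y
    using that \<gamma>(2) \<delta>(2) unfolding near_def by blast
  with \<beta>(2) \<delta>(1) show ?thesis by metis
qed

text \<open>Two rounds of \<open>near_compose\<close>, merging \<open>a, b, c\<close> and
  \<open>c, d, e\<close> first. Four links is the length of the chain in
  \<open>sensitive_at\<close>.\<close>

lemma near_compose4:
  assumes "\<alpha> \<in> \<Lambda>"
  shows "\<exists>\<beta>\<in>\<Lambda>. \<forall>a\<in>X. \<forall>b\<in>X. \<forall>c\<in>X. \<forall>d\<in>X. \<forall>e\<in>X.
    near \<beta> a b \<and> near \<beta> b c \<and> near \<beta> c d \<and> near \<beta> d e \<longrightarrow> e \<in> V \<alpha> a"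
proof -
  obtain \<beta> where \<beta>: "\<beta> \<in> \<Lambda>"
    "\<And>x y z. \<lbrakk>x \<in> X; y \<in> X; z \<in> X; near \<beta> x y; near \<beta> y z\<rbrakk> \<Longrightarrow> z \<in> V \<alpha> x"
    using near_compose[OF assms] by meson
  obtain \<gamma> where \<gamma>: "\<gamma> \<in> \<Lambda>"
    "\<And>x y z. \<lbrakk>x \<in> X; y \<in> X; z \<in> X; near \<gamma> x y; near \<gamma> y z\<rbrakk> \<Longrightarrow> z \<in> V \<beta> x"
    using near_compose[OF \<beta>(1)] by meson
  have "e \<in> V \<alpha> a"
    if "a \<in> X" "b \<in> X" "c \<in> X" "d \<in> X" "e \<in> X"
      "near \<gamma> a b \<and> near \<gamma> b c \<and> near \<gamma> c d \<and> near \<gamma> d e" for a b c d e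
    using \<beta>(2)[of a c e] \<gamma>(2)[of a b c] \<gamma>(2)[of c d e] that by (auto simp: near_def)
  with \<gamma>(1) show ?thesis by blast
qed

lemma open_in_basic_neighborhood:
  assumes "x \<in> X" "\<alpha> \<in> \<Lambda>"
  obtains U where "openin (unif_topology X \<Lambda> V) U" "x \<in> U" "U \<subseteq> V \<alpha> x"
proof -
  have "neighborhood_of (unif_topology X \<Lambda> V) x (V \<alpha> x)"
    using neighborhood_of_unif_topology[OF assms(1)] range_V[OF assms(2,1)] assms(2) by blast
  then show ?thesis using that unfolding neighborhood_of_def by blast
qed

lemma separate_points:
  assumes "Hausdorff_space (unif_topology X \<Lambda> V)" "a \<in> X" "b \<in> X" "a \<noteq> b"
  shows "\<exists>\<delta>\<in>\<Lambda>. \<forall>x\<in>X. \<not> (a \<in> V \<delta> x \<and> b \<in> V \<delta> x)"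
proof -
  obtain U where U: "openin (unif_topology X \<Lambda> V) U" "a \<in> U" "b \<notin> U"
    using assms unfolding Hausdorff_space_def topspace_unif_topology disjnt_iff by metis
  then obtain \<alpha> where \<alpha>: "\<alpha> \<in> \<Lambda>" "b \<notin> V \<alpha> a" unfolding openin_unif_topology by blast
  \<comment> \<open>A point \<open>x\<close> close to both would give the chain
    \<open>a, x, b\<close> and hence \<open>b \<in> V \<alpha> a\<close>.\<close>
  show ?thesis using near_compose[OF \<alpha>(1)] assms(2,3) \<alpha>(2) unfolding near_def by meson
qed

text \<open>There are only finitely many pairs from \<open>A \<times> B\<close>, so the indices that
  separate them have a common refinement.\<close>

lemma separate_finite_sets:
  assumes "Hausdorff_space (unif_topology X \<Lambda> V)" "finite A" "finite B"
    "A \<subseteq> X" "B \<subseteq> X" "A \<inter> B = {}"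
  shows "\<exists>\<delta>\<in>\<Lambda>. \<forall>x\<in>X. A \<inter> V \<delta> x = {} \<or> B \<inter> V \<delta> x = {}"
proof -
  have "\<forall>c\<in>A \<times> B. \<exists>\<delta>. \<delta> \<in> \<Lambda> \<and> (\<forall>x\<in>X. \<not> (fst c \<in> V \<delta> x \<and> snd c \<in> V \<delta> x))"
  proof
    fix c assume "c \<in> A \<times> B"
    then have "fst c \<in> X" "snd c \<in> X" "fst c \<noteq> snd c" using assms(4-6) by auto
    from separate_points[OF assms(1) this]
    show "\<exists>\<delta>. \<delta> \<in> \<Lambda> \<and> (\<forall>x\<in>X. \<not> (fst c \<in> V \<delta> x \<and> snd c \<in> V \<delta> x))" by blast
  qed
  from bchoice[OF this] obtain d
    where d: "\<forall>c\<in>A \<times> B. d c \<in> \<Lambda> \<and> (\<forall>x\<in>X. \<not> (fst c \<in> V (d c) x \<and> snd c \<in> V (d c) x))"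
    by (rule exE)
  have "finite (d ` (A \<times> B))" using assms(2,3) by blast
  moreover have "d ` (A \<times> B) \<subseteq> \<Lambda>" using d by (intro image_subsetI) blast
  ultimately obtain \<delta> where \<delta>: "\<delta> \<in> \<Lambda>" "\<forall>\<alpha>\<in>d ` (A \<times> B). \<forall>x\<in>X. V \<delta> x \<subseteq> V \<alpha> x"
    by (rule bexE[OF finite_common_refinement])
  have "A \<inter> V \<delta> x = {} \<or> B \<inter> V \<delta> x = {}" if "x \<in> X" for x
  proof (rule ccontr)
    assume "\<not> ?thesis"
    then obtain a b where "a \<in> A" "b \<in> B" "a \<in> V \<delta> x" "b \<in> V \<delta> x" by blast
    moreover from this have "V \<delta> x \<subseteq> V (d (a, b)) x" using \<delta>(2) that by blast
    ultimately show False using d[THEN bspec, of "(a, b)"] that by auto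
  qed
  with \<delta>(1) show ?thesis by blast
qed

section \<open>Shadowing an orbit, and sensitivity\<close>

lemma open_shadowing_set:
  assumes cont: "continuous_map (unif_topology X \<Lambda> V) (unif_topology X \<Lambda> V) f"
    and "q \<in> X" "\<alpha> \<in> \<Lambda>"
  obtains W where "openin (unif_topology X \<Lambda> V) W" "q \<in> W"
    "\<forall>w\<in>W. \<forall>i\<le>n. (f ^^ i) w \<in> V \<alpha> ((f ^^ i) q)"
proof -
  let ?T = "unif_topology X \<Lambda> V"
  have "(f ^^ i) q \<in> X" for i
    using forward_orbit_subset_topspace[OF cont, of q] \<open>q \<in> X\<close>
    by (auto simp: topspace_unif_topology forward_orbit_def)
  then have "\<exists>U. openin ?T U \<and> (f ^^ i) q \<in> U \<and> U \<subseteq> V \<alpha> ((f ^^ i) q)" for i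
    using open_in_basic_neighborhood[OF _ \<open>\<alpha> \<in> \<Lambda>\<close>] by metis
  then obtain G where G: "\<And>i. openin ?T (G i)" "\<And>i. (f ^^ i) q \<in> G i"
    "\<And>i. G i \<subseteq> V \<alpha> ((f ^^ i) q)" by metis
  \<comment> \<open>The open sets \<open>G i\<close> stand in for the neighborhoods, which need not
    be open; a finite time horizon keeps the intersection open.\<close>
  let ?W = "\<Inter>i\<in>{..n}. {w \<in> topspace ?T. (f ^^ i) w \<in> G i}"
  have "openin ?T ?W"
    by (intro openin_INT2 openin_continuous_map_preimage[OF continuous_map_funpow[OF cont]] G) auto
  moreover have "q \<in> ?W" using G(2) \<open>q \<in> X\<close> by (auto simp: topspace_unif_topology)
  moreover have "\<forall>w\<in>?W. \<forall>i\<le>n. (f ^^ i) w \<in> V \<alpha> ((f ^^ i) q)"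
    using G(3) by auto
  ultimately show ?thesis by (rule that)
qed

text \<open>The index \<open>\<epsilon>\<close> depends on \<open>\<delta>\<close> alone, which
  makes the estimate uniform in \<open>x\<close>. The witness is one of two periodic points in
  \<open>N\<close>, as not both can stay \<open>\<epsilon>\<close>-close to
  \<open>x\<close>.\<close>

lemma sensitive_at:
  assumes chaos: "chaotic_on (unif_topology X \<Lambda> V) f"
    and x: "x \<in> X" and nb: "neighborhood_of (unif_topology X \<Lambda> V) x N"
    and q: "q \<in> X" and far: "forward_orbit f q \<inter> V \<delta> x = {}"
    and \<epsilon>: "\<epsilon> \<in> \<Lambda>"
      "\<forall>a\<in>X. \<forall>b\<in>X. \<forall>c\<in>X. \<forall>d\<in>X. \<forall>e\<in>X.
        near \<epsilon> a b \<and> near \<epsilon> b c \<and> near \<epsilon> c d \<and> near \<epsilon> d e \<longrightarrow> e \<in> V \<delta> a"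
  shows "\<exists>y\<in>N. y \<noteq> x \<and> (\<exists>n>0. (f ^^ n) x \<notin> V \<epsilon> ((f ^^ n) y))"
proof -
  let ?T = "unif_topology X \<Lambda> V"
  have cont: "continuous_map ?T ?T f" using chaos by (simp add: chaotic_on_def)
  have orb: "(f ^^ i) u \<in> X" if "u \<in> X" for i u
    using forward_orbit_subset_topspace[OF cont, of u] that
    by (auto simp: topspace_unif_topology forward_orbit_def)
  obtain U1 where U1: "openin ?T U1" "x \<in> U1" "U1 \<subseteq> N"
    using nb by (auto simp: neighborhood_of_def)
  obtain U2 where U2: "openin ?T U2" "x \<in> U2" "U2 \<subseteq> V \<epsilon> x"
    by (rule open_in_basic_neighborhood[OF x \<epsilon>(1)])
  \<comment> \<open>\<open>U1\<close> puts the candidates for the witness into \<open>N\<close>;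
    \<open>U2\<close> makes \<open>p\<close> close to \<open>x\<close>.\<close>
  define U where "U = U1 \<inter> U2"
  have U: "openin ?T U" "U \<noteq> {}" "U \<subseteq> N" "U \<subseteq> V \<epsilon> x" "U \<subseteq> X"
    using U1 U2 openin_subset[OF U1(1)] by (auto simp: U_def topspace_unif_topology)
  obtain p0 p where p0: "periodic_point f p0" and p: "p \<in> forward_orbit f p0" "p \<in> U"
    using chaos U(1,2) unfolding chaotic_on_def by blast
  obtain n where n: "n > 0" "(f ^^ n) p = p"
    using periodic_point_orbit[OF p0 p(1)] by (auto simp: periodic_point_def)
  obtain W where W: "openin ?T W" "q \<in> W"
    "\<forall>w\<in>W. \<forall>i\<le>n. (f ^^ i) w \<in> V \<epsilon> ((f ^^ i) q)"
    by (rule open_shadowing_set[OF cont q \<epsilon>(1), where n = n])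
  have "W \<noteq> {}" using W(2) by blast
  then obtain r y w where r: "periodic_point f r"
    and y: "y \<in> U" "y \<in> forward_orbit f r" and w: "w \<in> W" "w \<in> forward_orbit f r"
    using chaos U(1,2) W(1) unfolding chaotic_on_def by blast
  obtain k where k: "w = (f ^^ k) y" using periodic_orbit_return[OF r y(2) w(2)] by blast
  \<comment> \<open>The least multiple of the period \<open>n\<close> exceeding \<open>k\<close>: at
    time \<open>m\<close> the point \<open>p\<close> is back at itself, while at most
    \<open>n\<close> steps have passed since \<open>y\<close> entered \<open>W\<close> at time
    \<open>k\<close>, so the shadowing of \<open>q\<close> still holds.\<close>
  define m where "m = n * (k div n + 1)"
  have m: "m > 0" using n(1) by (simp add: m_def)
  have "m = n * (k div n) + n" by (simp add: m_def)
  then have mk: "k \<le> m" "m - k \<le> n"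
    using mod_less_divisor[OF n(1), of k] mult_div_mod_eq[of n k] by linarith+
  have "(f ^^ m) y = (f ^^ (m - k + k)) y" using mk(1) by simp
  also have "\<dots> = (f ^^ (m - k)) w" by (simp only: k funpow_add o_apply)
  finally have ym: "(f ^^ m) y \<in> V \<epsilon> ((f ^^ (m - k)) q)" using W(3) w(1) mk(2) by simp
  have pm: "(f ^^ m) p = p" unfolding m_def by (rule funpow_mult_period[OF n(2)])
  have "\<exists>z\<in>{p, y}. (f ^^ m) x \<notin> V \<epsilon> ((f ^^ m) z)"
  proof (rule ccontr)
    assume "\<not> ?thesis"
    then have *: "(f ^^ m) x \<in> V \<epsilon> p" "(f ^^ m) x \<in> V \<epsilon> ((f ^^ m) y)" using pm by auto
    \<comment> \<open>These four links lead from \<open>x\<close> to a point on the orbit of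
      \<open>q\<close>, against \<open>far\<close>.\<close>
    have "near \<epsilon> x p" "near \<epsilon> p ((f ^^ m) x)" "near \<epsilon> ((f ^^ m) x) ((f ^^ m) y)"
      "near \<epsilon> ((f ^^ m) y) ((f ^^ (m - k)) q)"
      using * p(2) U(4) ym by (auto simp: near_def)
    moreover have "p \<in> X" "y \<in> X" using p(2) y(1) U(5) by auto
    ultimately have "(f ^^ (m - k)) q \<in> V \<delta> x"
      using \<epsilon>(2) x q orb by metis
    with far show False by (auto simp: forward_orbit_def)
  qed
  then obtain z where z: "z \<in> {p, y}" "(f ^^ m) x \<notin> V \<epsilon> ((f ^^ m) z)" by blast
  \<comment> \<open>For \<open>z = x\<close> the two iterates would coincide, and a point lies in
    its own neighborhood.\<close>
  have "z \<noteq> x" using z(2) center[OF \<epsilon>(1) orb[OF x]] by blast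
  moreover have "z \<in> N" using z(1) p(2) y(1) U(3) by blast
  ultimately show ?thesis using z(2) m by blast
qed

lemma chaotic_imp_sensitive:
  assumes "infinite X" and haus: "Hausdorff_space (unif_topology X \<Lambda> V)"
    and chaos: "chaotic_on (unif_topology X \<Lambda> V) f"
  shows "sensitive_dependence X \<Lambda> V f"
proof -
  have cont: "continuous_map (unif_topology X \<Lambda> V) (unif_topology X \<Lambda> V) f"
    using chaos by (simp add: chaotic_on_def)
  obtain p q where pq: "p \<in> X" "q \<in> X" "periodic_point f p" "periodic_point f q"
    "forward_orbit f p \<inter> forward_orbit f q = {}"
    using chaotic_disjoint_orbits[OF chaos haus] \<open>infinite X\<close>
    unfolding topspace_unif_topology by blast
  have "forward_orbit f u \<subseteq> X" if "u \<in> X" for u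
    using forward_orbit_subset_topspace[OF cont] that by (simp add: topspace_unif_topology)
  with pq obtain \<delta> where \<delta>: "\<delta> \<in> \<Lambda>"
    "\<And>x. x \<in> X \<Longrightarrow> forward_orbit f p \<inter> V \<delta> x = {} \<or> forward_orbit f q \<inter> V \<delta> x = {}"
    using separate_finite_sets[OF haus] periodic_orbit_finite by metis
  obtain \<epsilon> where \<epsilon>: "\<epsilon> \<in> \<Lambda>"
    "\<forall>a\<in>X. \<forall>b\<in>X. \<forall>c\<in>X. \<forall>d\<in>X. \<forall>e\<in>X.
      near \<epsilon> a b \<and> near \<epsilon> b c \<and> near \<epsilon> c d \<and> near \<epsilon> d e \<longrightarrow> e \<in> V \<delta> a"
    using near_compose4[OF \<delta>(1)] by (rule bexE)
  have "\<exists>y\<in>N. y \<noteq> x \<and> (\<exists>n>0. (f ^^ n) x \<notin> V \<epsilon> ((f ^^ n) y))"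
    if "x \<in> X" "neighborhood_of (unif_topology X \<Lambda> V) x N" for x N
    \<comment> \<open>Whichever of the two orbits avoids \<open>V \<delta> x\<close> plays the role
      of the far orbit; the choice varies with \<open>x\<close>, but \<open>\<epsilon>\<close> does
      not.\<close>
    using \<delta>(2)[OF that(1)] sensitive_at[OF chaos that _ _ \<epsilon>] pq(1,2) by blast
  with \<epsilon>(1) show ?thesis unfolding sensitive_dependence_def by blast
qed

end

theorem theorem1:
  fixes X :: "'a set"
    and \<Lambda> :: "'i set"
    and geq :: "'i \<Rightarrow> 'i \<Rightarrow> bool"
    and V :: "'i \<Rightarrow> 'a \<Rightarrow> 'a set"
    and f :: "'a \<Rightarrow> 'a"
  assumes "uniform_neighborhood_system X \<Lambda> geq V"
    and "infinite X"
    and "Hausdorff_space (unif_topology X \<Lambda> V)"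
    and "continuous_map (unif_topology X \<Lambda> V) (unif_topology X \<Lambda> V) f"
    and "chaotic_on (unif_topology X \<Lambda> V) f"
  shows "sensitive_dependence X \<Lambda> V f"
  using uniform_neighborhood_system.chaotic_imp_sensitive[OF assms(1-3,5)] .

end
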